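(* Let $\alpha>1$, $p\in[0,1]$, and $$u_{2\alpha,p}(x,t)=\frac{1}{(\alpha t)^{1/\alpha}}\left[p\,\mathrm{Ai}_{\alpha}\left(-\frac{x}{(\alpha t)^{1/\alpha}}\right)+(1-p)\,\mathrm{Ai}_{\alpha}\left(\frac{x}{(\alpha t)^{1/\alpha}}\right)\right].$$ Then for all $x\in\mathbb{R}\setminus\{0\}$ and $t>0$, $$u_{2\alpha,p}(x,t)=\frac{1}{\pi x}\,\mathbb{E}\left[\sin\left(a_\alpha x\,G_{\alpha}(1/t)\right)\left(p\,e^{b_\alpha x\,G_{\alpha}(1/t)}+(1-p)\,e^{-b_\alpha x\,G_{\alpha}(1/t)}\right)\right],$$ where $a_\alpha=\cos\frac{\pi}{2\alpha}$, $b_\alpha=\sin\frac{\pi}{2\alpha}$, and, for $\gamma,\tau>0$, $G_{\gamma}(\tau)$ denotes a random variable with Weibull distribution having probability density function $g_{\gamma}(y;\tau)=\gamma\frac{y^{\gamma-1}}{\tau}\exp\left(-\frac{y^{\gamma}}{\tau}\right)$, $y>0$.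
   Context: For real $\alpha>1$ the generalized Airy function is $\mathrm{Ai}_{\alpha}(x)=\frac{1}{\pi}\int_0^{+\infty}\cos\left(sx+\frac{s^{\alpha}}{\alpha}\right)ds$, $x\in\mathbb{R}$ (convergent improper Riemann integral). *)

theory Defs
  imports "HOL-Probability.Probability"
begin

definition gen_airy :: "real \<Rightarrow> real \<Rightarrow> real" where
  "gen_airy \<alpha> x =
     1 / pi * Lim at_top (\<lambda>R. integral {0..R} (\<lambda>s. cos (s * x + s powr \<alpha> / \<alpha>)))"

(* The function usually written with subscripts (2 * \<alpha>, p); the first argument here is \<alpha>, not 2 * \<alpha>. *)
definition u_sol :: "real \<Rightarrow> real \<Rightarrow> real \<Rightarrow> real \<Rightarrow> real" where
  "u_sol \<alpha> p x t =
     1 / (\<alpha> * t) powr (1 / \<alpha>) *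
       (p * gen_airy \<alpha> (- x / (\<alpha> * t) powr (1 / \<alpha>)) +
        (1 - p) * gen_airy \<alpha> (x / (\<alpha> * t) powr (1 / \<alpha>)))"

definition weibull_density :: "real \<Rightarrow> real \<Rightarrow> real \<Rightarrow> real" where
  "weibull_density \<gamma> \<tau> y =
     (if y > 0 then \<gamma> * (y powr (\<gamma> - 1) / \<tau>) * exp (- (y powr \<gamma> / \<tau>)) else 0)"

end

(* The integrand of Ai is the real part of the function, holomorphic on the right half plane,
   F(w) = exp(i(x w + t w^alpha)). Rotating the half line by pi/(2 alpha) turns i w^alpha into
   -y^alpha, and the arc at infinity is negligible because sin y >= y/2 on [0, pi/2]. Integrating
   by parts on the rotated ray produces the Weibull density as the derivative of -exp(-t y^alpha),
   with the factor 1/x, and the sine comes from taking imaginary parts. *)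
theory Submission
  imports Defs "HOL-Complex_Analysis.Cauchy_Integral_Theorem" "HOL-Real_Asymp.Real_Asymp"
begin

section \<open>Size of the phase on circular arcs\<close>

lemma half_le_sin:
  fixes y :: real
  assumes "0 \<le> y" "y \<le> pi / 2"
  shows "y / 2 \<le> sin y"
proof -
  have "\<bar>sin y - (\<Sum>m<3. sin_coeff m * y ^ m)\<bar> \<le> inverse (fact 3) * \<bar>y\<bar> ^ 3"
    by (rule Maclaurin_sin_bound)
  moreover have "(\<Sum>m<3. sin_coeff m * y ^ m) = y"
    by (simp add: eval_nat_numeral sin_coeff_def)
  ultimately have "\<bar>sin y - y\<bar> \<le> y ^ 3 / 6"
    using assms(1) by (simp add: fact_numeral field_simps)
  \<comment> \<open>The cubic Taylor error is absorbed because \<open>pi / 2 \<le> 1.6\<close> and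
    \<open>1.6 * 1.6 = 2.56 < 3\<close>. The constant 1/2 is weaker than the sharp 2/pi of Jordan's
    inequality, but any positive constant serves to kill the arc.\<close>
  moreover have "y ^ 3 / 6 \<le> y / 2"
  proof -
    have "y \<le> 1.6" using assms(2) pi_approx by simp
    hence "y * y \<le> 1.6 * 1.6" using assms(1) by (intro mult_mono) auto
    hence "y * (y * y) \<le> y * 3" using assms(1) by (intro mult_left_mono) auto
    thus ?thesis by (simp add: power3_eq_cube mult.assoc)
  qed
  ultimately show ?thesis by linarith
qed

text \<open>For an angle in the principal range, \<open>Ln\<close> has imaginary part exactly
  \<open>\<phi>\<close>, so the principal power multiplies the angle by \<open>\<alpha>\<close>,
  even if the product leaves that range. At \<open>R = 0\<close> both sides vanish by the convention
  for \<open>0 powr \<alpha>\<close>.\<close>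

lemma powr_of_real_mult_cis:
  assumes "R \<ge> 0" "\<phi> \<in> {-pi<..pi}"
  shows "(of_real R * cis \<phi>) powr of_real \<alpha> = of_real (R powr \<alpha>) * cis (\<alpha> * \<phi>)"
proof (cases "R = 0")
  case False
  hence "R > 0" using assms by simp
  have "Ln (of_real R * cis \<phi>) = of_real (ln R) + \<i> * of_real \<phi>"
    using Ln_rcis[OF \<open>R > 0\<close> assms(2)] by (simp add: rcis_def complex_eq_iff)
  hence "(of_real R * cis \<phi>) powr of_real \<alpha>
      = exp (of_real \<alpha> * of_real (ln R) + \<i> * of_real (\<alpha> * \<phi>))"
    using \<open>R > 0\<close> by (simp add: powr_def cis_neq_zero algebra_simps)
  also have "\<dots> = of_real (R powr \<alpha>) * cis (\<alpha> * \<phi>)"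
    using \<open>R > 0\<close> by (simp add: exp_add powr_def exp_of_real cis_conv_exp flip: of_real_mult)
  finally show ?thesis .
qed auto

text \<open>A general \<open>t\<close> stands where the Airy integrand has
  \<open>1 / \<alpha>\<close>; this way the Weibull parameter \<open>1 / t\<close> appears directly,
  and the scaling is postponed to \<open>gen_airy_rescaled\<close>.\<close>

definition airy_phase :: "real \<Rightarrow> real \<Rightarrow> real \<Rightarrow> complex \<Rightarrow> complex" where
  "airy_phase \<alpha> x t w = exp (\<i> * (of_real x * w + of_real t * w powr of_real \<alpha>))"

text \<open>The linear term grows by at most \<open>\<bar>sin \<phi>\<bar> \<le> \<phi>\<close>, and
  the power term decays at least linearly by \<open>half_le_sin\<close>, as
  \<open>\<alpha> * \<phi> \<le> pi / 2\<close>. An exponent linear in \<open>\<phi>\<close> makes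
  the integral of the bound over the arc explicit.\<close>

lemma norm_airy_phase_le:
  assumes "\<alpha> > 1" "t > 0" "R \<ge> 0" "0 \<le> \<phi>" "\<phi> \<le> pi / (2 * \<alpha>)"
  shows "norm (airy_phase \<alpha> x t (of_real R * cis \<phi>))
           \<le> exp (- (t * \<alpha> / 2 * R powr \<alpha> - \<bar>x\<bar> * R) * \<phi>)"
proof -
  have "pi / (2 * \<alpha>) \<le> pi" using assms pi_gt_zero by (simp add: field_simps)
  hence phi: "\<phi> \<in> {-pi<..pi}" using assms pi_gt_zero by (auto intro: less_le_trans[of _ 0])
  have "norm (airy_phase \<alpha> x t (of_real R * cis \<phi>))
      = exp (- (x * R * sin \<phi> + t * R powr \<alpha> * sin (\<alpha> * \<phi>)))"
    using assms unfolding airy_phase_def powr_of_real_mult_cis[OF assms(3) phi]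
    by (simp add: algebra_simps)
  also have "\<dots> \<le> exp (- (t * \<alpha> / 2 * R powr \<alpha> - \<bar>x\<bar> * R) * \<phi>)"
  proof -
    have "\<bar>x * R * sin \<phi>\<bar> \<le> \<bar>x\<bar> * R * \<phi>"
      using assms abs_sin_x_le_abs_x[of \<phi>] by (auto simp: abs_mult intro!: mult_left_mono)
    moreover have "\<alpha> * \<phi> \<le> pi / 2"
      using assms by (simp add: field_simps)
    hence "\<alpha> * \<phi> / 2 \<le> sin (\<alpha> * \<phi>)"
      using assms by (intro half_le_sin) auto
    hence "t * R powr \<alpha> * (\<alpha> * \<phi> / 2) \<le> t * R powr \<alpha> * sin (\<alpha> * \<phi>)"
      using assms by (intro mult_left_mono) auto
    ultimately show ?thesis by (simp add: algebra_simps)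
  qed
  finally show ?thesis .
qed

section \<open>Contour rotation by means of a primitive\<close>

lemma airy_phase_primitive:
  assumes "\<alpha> > 0"
  obtains g where "\<And>w. Re w \<ge> 0 \<Longrightarrow>
    (g has_field_derivative airy_phase \<alpha> x t w) (at w within {w. Re w \<ge> 0})"
\<comment> \<open>Holomorphy is only asked for in the open half plane. At the branch point 0
  continuity is enough, and it holds there because \<open>\<alpha> > 0\<close>.\<close>
proof (rule holomorphic_convex_primitive[of "{w. Re w \<ge> 0}" "{}" "airy_phase \<alpha> x t"])
  show "convex {w. 0 \<le> Re w}" by (rule convex_halfspace_Re_ge)
  show "continuous_on {w. 0 \<le> Re w} (airy_phase \<alpha> x t)"
    using assms unfolding airy_phase_def by (intro continuous_intros) auto
  fix w assume "w \<in> interior {w. 0 \<le> Re w} - {}"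
  hence "Re w > 0" using interior_halfspace_ge[of "1::complex" 0] by (simp add: inner_complex_def)
  hence "w \<notin> \<real>\<^sub>\<le>\<^sub>0" by (auto simp: complex_nonpos_Reals_iff)
  thus "airy_phase \<alpha> x t field_differentiable at w"
    unfolding airy_phase_def field_differentiable_def
    by (auto intro!: exI derivative_eq_intros)
qed (use that in auto)

text \<open>Used with \<open>c = 1\<close> for the real axis and with
  \<open>c = cis (pi / (2 * \<alpha>))\<close> for the rotated ray. Both start from
  \<open>g 0\<close>, so the two integrals differ only by the increment of \<open>g\<close> along
  the arc.\<close>

lemma ray_integral:
  assumes g: "\<And>w. Re w \<ge> 0 \<Longrightarrow> (g has_field_derivative f w) (at w within {w. Re w \<ge> 0})"
    and "Re c \<ge> 0" "R \<ge> 0"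
  shows "((\<lambda>s. c * f (of_real s * c)) has_integral (g (of_real R * c) - g 0)) {0..R}"
proof -
  have "((\<lambda>s. c * f (of_real s * c)) has_integral
          ((g \<circ> (\<lambda>s. of_real s * c)) R - (g \<circ> (\<lambda>s. of_real s * c)) 0)) {0..R}"
  proof (rule fundamental_theorem_of_calculus[OF \<open>R \<ge> 0\<close>])
    fix s assume s: "s \<in> {0..R}"
    show "((g \<circ> (\<lambda>s. of_real s * c)) has_vector_derivative c * f (of_real s * c)) (at s within {0..R})"
    proof (rule field_vector_diff_chain_within)
      show "((\<lambda>s. of_real s * c) has_vector_derivative c) (at s within {0..R})"
        by (auto intro!: derivative_eq_intros)
      show "(g has_field_derivative f (of_real s * c)) (at (of_real s * c) within (\<lambda>s. of_real s * c) ` {0..R})"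
        using s assms by (intro DERIV_subset[OF g]) auto
    qed
  qed
  thus ?thesis by simp
qed

text \<open>The increment is the integral of the phase over the arc, at most the integral of
  \<open>R * exp (- k * \<phi>)\<close> and hence at most \<open>R / k\<close>, where k is the decay
  rate from \<open>norm_airy_phase_le\<close>. Since \<open>\<alpha> > 1\<close>, the quotient
  \<open>k / R\<close> tends to infinity.\<close>

lemma arc_increment_tendsto_0:
  assumes "\<alpha> > 1" "t > 0"
    and g: "\<And>w. Re w \<ge> 0 \<Longrightarrow>
      (g has_field_derivative airy_phase \<alpha> x t w) (at w within {w. Re w \<ge> 0})"
  defines "\<theta> \<equiv> pi / (2 * \<alpha>)"
  shows "((\<lambda>R. g (of_real R * cis \<theta>) - g (of_real R)) \<longlongrightarrow> 0) at_top"
proof (rule Lim_null_comparison)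
  let ?k = "\<lambda>R. t * \<alpha> / 2 * R powr \<alpha> - \<bar>x\<bar> * R"
  have th: "0 \<le> \<theta>" "\<theta> \<le> pi / 2" using assms(1) by (auto simp: \<theta>_def field_simps)
  have lim: "filterlim (\<lambda>R. t * \<alpha> / 2 * R powr (\<alpha> - 1) - \<bar>x\<bar>) at_top at_top"
    using assms(1,2) by real_asymp
  show "((\<lambda>R. 1 / (t * \<alpha> / 2 * R powr (\<alpha> - 1) - \<bar>x\<bar>)) \<longlongrightarrow> 0) at_top"
    by (intro tendsto_divide_0[OF tendsto_const] filterlim_at_top_imp_at_infinity lim)
  have "eventually (\<lambda>R. t * \<alpha> / 2 * R powr (\<alpha> - 1) - \<bar>x\<bar> > 0) at_top"
    using lim unfolding filterlim_at_top_dense by blast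
  thus "\<forall>\<^sub>F R in at_top. norm (g (of_real R * cis \<theta>) - g (of_real R))
            \<le> 1 / (t * \<alpha> / 2 * R powr (\<alpha> - 1) - \<bar>x\<bar>)"
    using eventually_gt_at_top[of 0]
  proof eventually_elim
    case (elim R)
    have k: "?k R = R * (t * \<alpha> / 2 * R powr (\<alpha> - 1) - \<bar>x\<bar>)"
      using \<open>R > 0\<close> by (simp add: powr_diff field_simps)
    have k_pos: "?k R > 0" unfolding k using elim by simp
    let ?\<gamma> = "\<lambda>\<phi>. of_real R * cis \<phi>"
    have Re_pos: "Re (?\<gamma> \<phi>) \<ge> 0" if "\<phi> \<in> {0..\<theta>}" for \<phi>
      using that th elim by (auto intro!: mult_nonneg_nonneg cos_ge_zero)
    have arc: "((\<lambda>\<phi>. (\<i> * ?\<gamma> \<phi>) * airy_phase \<alpha> x t (?\<gamma> \<phi>)) has_integral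
            ((g \<circ> ?\<gamma>) \<theta> - (g \<circ> ?\<gamma>) 0)) {0..\<theta>}"
    proof (rule fundamental_theorem_of_calculus[OF th(1)])
      fix \<phi> assume phi: "\<phi> \<in> {0..\<theta>}"
      show "((g \<circ> ?\<gamma>) has_vector_derivative \<i> * ?\<gamma> \<phi> * airy_phase \<alpha> x t (?\<gamma> \<phi>)) (at \<phi> within {0..\<theta>})"
      proof (rule field_vector_diff_chain_within)
        show "(?\<gamma> has_vector_derivative \<i> * ?\<gamma> \<phi>) (at \<phi> within {0..\<theta>})"
          unfolding has_vector_derivative_def
          by (auto intro!: derivative_eq_intros simp: scaleR_conv_of_real algebra_simps)
        show "(g has_field_derivative airy_phase \<alpha> x t (?\<gamma> \<phi>)) (at (?\<gamma> \<phi>) within ?\<gamma> ` {0..\<theta>})"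
          using Re_pos phi by (intro DERIV_subset[OF g]) auto
      qed
    qed
    \<comment> \<open>The majorant is integrated for an abstract rate \<open>k > 0\<close>, and the
      actual rate \<open>?k R\<close> is inserted afterwards.\<close>
    have "((\<lambda>\<phi>. R * exp (- k * \<phi>)) has_integral
            (- R / k * exp (- k * \<theta>) - (- R / k * exp (- k * 0)))) {0..\<theta>}" if "k > 0" for k
      using that
      by (intro fundamental_theorem_of_calculus[OF th(1)])
         (auto intro!: derivative_eq_intros simp flip: has_real_derivative_iff_has_vector_derivative)
    note bound = this[OF k_pos]
    have "norm (g (?\<gamma> \<theta>) - g (of_real R)) 
        = norm (integral {0..\<theta>} (\<lambda>\<phi>. (\<i> * ?\<gamma> \<phi>) * airy_phase \<alpha> x t (?\<gamma> \<phi>)))"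
      using integral_unique[OF arc] by simp
    also have "\<dots> \<le> integral {0..\<theta>} (\<lambda>\<phi>. R * exp (- ?k R * \<phi>))"
    proof (rule integral_norm_bound_integral)
      fix \<phi> assume "\<phi> \<in> {0..\<theta>}"
      hence "norm (airy_phase \<alpha> x t (?\<gamma> \<phi>)) \<le> exp (- ?k R * \<phi>)"
        using assms(1,2) elim by (intro norm_airy_phase_le) (auto simp: \<theta>_def)
      thus "norm (\<i> * ?\<gamma> \<phi> * airy_phase \<alpha> x t (?\<gamma> \<phi>)) \<le> R * exp (- ?k R * \<phi>)"
        using elim by (simp add: norm_mult)
    qed (use arc bound in \<open>auto simp: has_integral_iff\<close>)
    also have "\<dots> = R / ?k R * (1 - exp (- ?k R * \<theta>))"
      using integral_unique[OF bound] by (simp add: right_diff_distrib)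
    also have "\<dots> \<le> R / ?k R * 1"
      using k_pos elim by (intro mult_left_mono) auto
    also have "\<dots> = 1 / (t * \<alpha> / 2 * R powr (\<alpha> - 1) - \<bar>x\<bar>)"
      unfolding k using elim by simp
    finally show ?case .
  qed
qed

section \<open>Weibull integrals on the rotated ray\<close>

lemma weibull_integration_by_parts:
  fixes z :: complex
  assumes "\<alpha> > 1" "R \<ge> 0"
  shows "((\<lambda>y. of_real (\<alpha> * t * y powr (\<alpha> - 1)) * exp (z * of_real y - of_real (t * y powr \<alpha>)))
     has_integral
       (1 - exp (z * of_real R - of_real (t * R powr \<alpha>))
         + z * integral {0..R} (\<lambda>y. exp (z * of_real y - of_real (t * y powr \<alpha>))))) {0..R}"
proof -
  let ?h = "\<lambda>y. exp (z * of_real y - of_real (t * y powr \<alpha>))"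
  have cont: "continuous_on {0..R} ?h"
    by (intro continuous_intros continuous_on_powr') (use assms in auto)
  \<comment> \<open>The derivative of \<open>?h\<close> is \<open>z * ?h\<close> minus the weighted
    integrand, so the latter can be solved for; the 1 in the result is \<open>?h 0\<close>. The
    power is differentiated only at \<open>y > 0\<close>, and continuity takes care of the endpoint
    0.\<close>
  have "((\<lambda>y. (z - of_real (\<alpha> * t * y powr (\<alpha> - 1))) * ?h y) has_integral (?h R - ?h 0)) {0..R}"
  proof (rule fundamental_theorem_of_calculus_interior[OF \<open>R \<ge> 0\<close> cont])
    fix y assume y: "y \<in> {0<..<R}"
    have "((\<lambda>y. complex_of_real (t * y powr \<alpha>)) has_vector_derivative of_real (\<alpha> * t * y powr (\<alpha> - 1))) (at y)"
      using y by (intro has_vector_derivative_of_real) (auto intro!: derivative_eq_intros)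
    hence "((\<lambda>y. z * of_real y - of_real (t * y powr \<alpha>)) has_vector_derivative
            (z - of_real (\<alpha> * t * y powr (\<alpha> - 1)))) (at y)"
      by (intro has_vector_derivative_diff) (auto intro!: derivative_eq_intros)
    from field_vector_diff_chain_at[OF this DERIV_exp]
    show "(?h has_vector_derivative (z - of_real (\<alpha> * t * y powr (\<alpha> - 1))) * ?h y) (at y)"
      by (simp add: o_def)
  qed
  moreover have "((\<lambda>y. z * ?h y) has_integral z * integral {0..R} ?h) {0..R}"
    using cont by (intro has_integral_mult_right integrable_integral integrable_continuous_real)
  ultimately have "((\<lambda>y. z * ?h y - (z - of_real (\<alpha> * t * y powr (\<alpha> - 1))) * ?h y) has_integral
      (z * integral {0..R} ?h - (?h R - ?h 0))) {0..R}"
    by (intro has_integral_diff)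
  thus ?thesis using assms by (simp add: algebra_simps)
qed

text \<open>Since \<open>\<alpha> > 1\<close>, the factor \<open>exp (- t * y powr \<alpha>)\<close>
  beats every exponential, so the integrand is dominated by a multiple of
  \<open>exp (- y)\<close>.\<close>

lemma weibull_exp_integrable:
  assumes "\<alpha> > 1" "t > 0"
  shows "set_integrable lborel {0..}
    (\<lambda>y. of_real (\<alpha> * t * y powr (\<alpha> - 1)) * exp (z * of_real y - of_real (t * y powr \<alpha>)) :: complex)"
    (is "set_integrable _ _ ?f")
proof -
  let ?C = "Re z"
  \<comment> \<open>This is the norm of the integrand times \<open>exp y\<close>, whence the
    \<open>+ 1\<close>. It suffices to bound it: by its limit 0 for large \<open>y\<close>, by
    compactness on the rest.\<close>
  let ?q = "\<lambda>y. \<alpha> * t * y powr (\<alpha> - 1) * exp ((?C + 1) * y - t * y powr \<alpha>)"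
  have "(?q \<longlongrightarrow> 0) at_top"
    using assms by real_asymp
  then have "eventually (\<lambda>y. norm (?q y) < 1) at_top"
    by (auto dest: tendstoD[where e = 1])
  then obtain B where "\<forall>y\<ge>B. norm (?q y) < 1"
    unfolding eventually_at_top_linorder by blast
  hence B: "norm (?q y) \<le> 1" if "y \<ge> B" for y
    using that less_imp_le by blast
  have "bounded (?q ` {0..B})"
    by (intro compact_imp_bounded compact_continuous_image continuous_intros continuous_on_powr')
       (use assms in auto)
  then obtain K where "\<forall>v \<in> ?q ` {0..B}. norm v \<le> K"
    unfolding bounded_iff by blast
  hence K: "norm (?q y) \<le> K" if "y \<in> {0..B}" for y
    using that by blast
  have le: "norm (?q y) \<le> max 1 K" if "y \<ge> 0" for y
    using B[of y] K[of y] that by (cases "y \<le> B") (auto simp: max_def)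
  \<comment> \<open>For a nonnegative function gauge integrability gives Lebesgue integrability;
    Borel measurability then allows passing from the completion to \<open>lborel\<close>.\<close>
  have "set_integrable lebesgue {0..} (\<lambda>y::real. exp (- 1 * y))"
    by (intro nonnegative_absolutely_integrable_1 integrable_on_exp_minus_to_infinity) auto
  hence exp_int: "set_integrable lborel {0..} (\<lambda>y::real. exp (- y))"
    unfolding set_integrable_def by (subst (asm) integrable_completion) auto
  show ?thesis
  proof (rule set_integrable_bound[OF set_integrable_mult_right[OF exp_int, of "max 1 K"]])
    show "set_borel_measurable lborel {0..} ?f"
      unfolding set_borel_measurable_def by measurable
    show "AE y in lborel. y \<in> {0..} \<longrightarrow> norm (?f y) \<le> norm (max 1 K * exp (- y))"
    proof (intro AE_I2 impI)
      fix y :: real assume "y \<in> {0..}"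
      hence y: "y \<ge> 0" by simp
      have "norm (?f y) = \<bar>\<alpha> * t * y powr (\<alpha> - 1)\<bar> * exp (?C * y - t * y powr \<alpha>)"
        by (simp add: norm_mult abs_mult)
      also have "\<dots> = norm (?q y) * exp (- y)"
        by (simp add: abs_mult algebra_simps flip: exp_add)
      also have "\<dots> \<le> max 1 K * exp (- y)"
        using le[OF y] by (intro mult_right_mono) auto
      finally show "norm (?f y) \<le> norm (max 1 K * exp (- y))" by simp
    qed
  qed
qed


section \<open>The oscillatory integral as a Weibull integral\<close>

lemma rotated_exponent:
  assumes "\<alpha> > 1" "s \<ge> 0"
  shows "airy_phase \<alpha> x t (of_real s * cis (pi / (2 * \<alpha>)))
    = exp (\<i> * of_real x * cis (pi / (2 * \<alpha>)) * of_real s - of_real (t * s powr \<alpha>))"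
proof -
  \<comment> \<open>The last equation fixes the choice of angle: the power acquires the factor
    \<open>cis (pi / 2)\<close>, and \<open>\<i> * cis (pi / 2) = - 1\<close>.\<close>
  have "pi / (2 * \<alpha>) \<le> pi" "pi / (2 * \<alpha>) > 0" "\<alpha> * (pi / (2 * \<alpha>)) = pi / 2"
    using assms pi_gt_zero by (auto simp: field_simps)
  thus ?thesis
    using assms(2) unfolding airy_phase_def
    by (subst powr_of_real_mult_cis) (auto simp: algebra_simps)
qed

text \<open>This is the complex form of the claim: with G Weibull distributed with parameter
  \<open>1 / t\<close>, the limit is the expectation of \<open>exp (z * G)\<close> minus 1. Keeping
  the factor \<open>x\<close> on the left avoids division, so \<open>x = 0\<close> is
  allowed.\<close>

lemma weibull_exp_limit:
  fixes \<alpha> x t :: real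
  assumes "\<alpha> > 1" "t > 0"
  defines "z \<equiv> \<i> * of_real x * cis (pi / (2 * \<alpha>))"
  shows "((\<lambda>R. \<i> * of_real x * integral {0..R} (\<lambda>s. airy_phase \<alpha> x t (of_real s))) \<longlongrightarrow>
    (LINT y:{0..}|lborel. of_real (\<alpha> * t * y powr (\<alpha> - 1)) *
        exp (z * of_real y - of_real (t * y powr \<alpha>))) - 1) at_top"
    (is "(_ \<longlongrightarrow> ?L - 1) _")
proof -
  let ?w = "\<lambda>y. of_real (\<alpha> * t * y powr (\<alpha> - 1)) * exp (z * of_real y - of_real (t * y powr \<alpha>))"
  let ?h = "\<lambda>y. exp (z * of_real y - of_real (t * y powr \<alpha>))"
  let ?c = "cis (pi / (2 * \<alpha>))"
  have "- (pi / 2) \<le> pi / (2 * \<alpha>)" "pi / (2 * \<alpha>) \<le> pi / 2"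
    using assms(1) pi_gt_zero by (auto simp: field_simps intro: order_trans[of _ 0])
  hence Re_c: "Re ?c \<ge> 0"
    by (simp add: cos_ge_zero)
  have "\<alpha> > 0" using assms(1) by simp
  then obtain g where g: "\<And>w. Re w \<ge> 0 \<Longrightarrow>
      (g has_field_derivative airy_phase \<alpha> x t w) (at w within {w. Re w \<ge> 0})"
    using airy_phase_primitive by blast
  have arc: "((\<lambda>R. g (of_real R * ?c) - g (of_real R)) \<longlongrightarrow> 0) at_top"
    using arc_increment_tendsto_0[OF assms(1,2) g] by simp
  have int: "set_integrable lborel {0..} ?w"
    by (rule weibull_exp_integrable[OF assms(1,2)])
  have "((\<lambda>R. LINT y:{0..R}|lborel. ?w y) \<longlongrightarrow> ?L) at_top"
    by (rule tendsto_set_lebesgue_integral_at_top[OF _ int]) auto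
  moreover have "(LINT y:{0..R}|lborel. ?w y) = integral {0..R} ?w" for R
    by (intro set_borel_integral_eq_integral set_integrable_subset[OF int]) auto
  ultimately have lim_w: "((\<lambda>R. integral {0..R} ?w) \<longlongrightarrow> ?L) at_top" by simp
  have lim_h: "(?h \<longlongrightarrow> 0) at_top"
  proof (rule tendsto_norm_zero_cancel)
    have "((\<lambda>R. exp (Re z * R - t * R powr \<alpha>)) \<longlongrightarrow> 0) at_top"
      using assms(1,2) by real_asymp
    thus "((\<lambda>R. norm (?h R)) \<longlongrightarrow> 0) at_top" by simp
  qed
  \<comment> \<open>For \<open>R \<ge> 0\<close> this combination equals the truncated integral
    exactly: integration by parts moves \<open>?w\<close> to the rotated ray, and the arc increment
    moves the ray to the real axis. Only the first integral and the constant survive in the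
    limit.\<close>
  have "((\<lambda>R. integral {0..R} ?w - 1 + ?h R
            - \<i> * of_real x * (g (of_real R * ?c) - g (of_real R))) \<longlongrightarrow> 
          ?L - 1 + 0 - \<i> * of_real x * 0) at_top"
    by (intro tendsto_intros lim_w lim_h arc)
  moreover have "\<forall>\<^sub>F R in at_top. integral {0..R} ?w - 1 + ?h R
            - \<i> * of_real x * (g (of_real R * ?c) - g (of_real R))
       = \<i> * of_real x * integral {0..R} (\<lambda>s. airy_phase \<alpha> x t (of_real s))"
    using eventually_ge_at_top[of 0]
  proof eventually_elim
    case (elim R)
    have real_axis: "integral {0..R} (\<lambda>s. airy_phase \<alpha> x t (of_real s)) = g (of_real R) - g 0"
      using integral_unique[OF ray_integral[OF g, of 1 R]] elim by simp
    have "?c * integral {0..R} ?h = integral {0..R} (\<lambda>s. ?c * ?h s)"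
      by simp
    also have "\<dots> = integral {0..R} (\<lambda>s. ?c * airy_phase \<alpha> x t (of_real s * ?c))"
      by (intro integral_cong) (simp add: rotated_exponent[OF assms(1)] z_def)
    also have "\<dots> = g (of_real R * ?c) - g 0"
      using integral_unique[OF ray_integral[OF g, of ?c R]] elim Re_c by simp
    finally have ray: "?c * integral {0..R} ?h = g (of_real R * ?c) - g 0" .
    have "integral {0..R} ?w = 1 - ?h R + z * integral {0..R} ?h"
      by (rule integral_unique[OF weibull_integration_by_parts[OF assms(1) elim]])
    also have "z * integral {0..R} ?h = \<i> * of_real x * (g (of_real R * ?c) - g 0)"
      unfolding ray[symmetric] by (simp add: z_def)
    finally show ?case unfolding real_axis by (simp add: algebra_simps)
  qed
  ultimately show ?thesis
    by (subst (asm) tendsto_cong) auto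
qed

text \<open>Both claims are imaginary parts of complex ones: \<open>\<i> * x\<close> turns the real
  part of the phase integral into an imaginary part, the real constant \<open>- 1\<close>
  disappears, and \<open>Re z = - b * x\<close>, \<open>Im z = a * x\<close> give the exponential
  and the sine.\<close>

lemma weibull_sin_exp_integral:
  assumes "\<alpha> > 1" "t > 0"
  defines "a \<equiv> cos (pi / (2 * \<alpha>))" and "b \<equiv> sin (pi / (2 * \<alpha>))"
  shows weibull_sin_exp_integrable:
      "integrable lborel (\<lambda>y. weibull_density \<alpha> (1 / t) y * (sin (a * x * y) * exp (- b * x * y)))"
    and weibull_sin_exp_limit:
      "((\<lambda>R. x * integral {0..R} (\<lambda>s. cos (s * x + t * s powr \<alpha>))) \<longlongrightarrow>
        (LINT y|lborel. weibull_density \<alpha> (1 / t) y * (sin (a * x * y) * exp (- b * x * y)))) at_top"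
proof -
  define z where "z = \<i> * of_real x * cis (pi / (2 * \<alpha>))"
  let ?w = "\<lambda>y. of_real (\<alpha> * t * y powr (\<alpha> - 1)) * exp (z * of_real y - of_real (t * y powr \<alpha>))"
  have z: "Re z = - b * x" "Im z = a * x"
    by (simp_all add: z_def a_def b_def)
  have Im_w: "Im (?w y) = \<alpha> * t * y powr (\<alpha> - 1) * (exp (- b * x * y - t * y powr \<alpha>) * sin (a * x * y))" for y
    by (simp add: Im_exp z)
  \<comment> \<open>The indicator includes 0 while the density is defined to be 0 there; the two
    sides agree at that point since \<open>0 powr (\<alpha> - 1) = 0\<close>.\<close>
  have w: "Im (indicator {0..} y *\<^sub>R ?w y)
      = weibull_density \<alpha> (1 / t) y * (sin (a * x * y) * exp (- b * x * y))" for y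
    unfolding scaleR_complex.sel Im_w using assms(1)
    by (auto simp: indicator_def weibull_density_def exp_diff exp_minus field_simps)
  have int: "integrable lborel (\<lambda>y. indicator {0..} y *\<^sub>R ?w y)"
    using weibull_exp_integrable[OF assms(1,2)] unfolding set_integrable_def by simp
  show "integrable lborel (\<lambda>y. weibull_density \<alpha> (1 / t) y * (sin (a * x * y) * exp (- b * x * y)))"
    using integrable_Im[OF int] unfolding w .
  have lim: "((\<lambda>R. Im (\<i> * of_real x * integral {0..R} (\<lambda>s. airy_phase \<alpha> x t (of_real s)))) \<longlongrightarrow>
      Im ((LINT y:{0..}|lborel. ?w y) - 1)) at_top"
    unfolding z_def by (intro tendsto_Im weibull_exp_limit assms)
  have L: "Im ((LINT y:{0..}|lborel. ?w y) - 1)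
      = (LINT y|lborel. weibull_density \<alpha> (1 / t) y * (sin (a * x * y) * exp (- b * x * y)))"
    unfolding set_lebesgue_integral_def w[symmetric] using integral_Im[OF int] by simp
  have I: "Im (\<i> * of_real x * integral {0..R} (\<lambda>s. airy_phase \<alpha> x t (of_real s)))
      = x * integral {0..R} (\<lambda>s. cos (s * x + t * s powr \<alpha>))" for R
  proof -
    have "(\<lambda>s. airy_phase \<alpha> x t (of_real s)) integrable_on {0..R}"
      unfolding airy_phase_def
      by (intro integrable_continuous_real continuous_intros) (use assms in auto)
    hence "Re (integral {0..R} (\<lambda>s. airy_phase \<alpha> x t (of_real s)))
        = integral {0..R} (\<lambda>s. Re (airy_phase \<alpha> x t (of_real s)))"
      by (rule sym[OF integral_linear[OF _ bounded_linear_Re, unfolded o_def]])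
    also have "\<dots> = integral {0..R} (\<lambda>s. cos (s * x + t * s powr \<alpha>))"
      by (intro integral_cong) (simp add: airy_phase_def Re_exp powr_of_real mult.commute)
    finally show ?thesis by simp
  qed
  show "((\<lambda>R. x * integral {0..R} (\<lambda>s. cos (s * x + t * s powr \<alpha>))) \<longlongrightarrow>
        (LINT y|lborel. weibull_density \<alpha> (1 / t) y * (sin (a * x * y) * exp (- b * x * y)))) at_top"
    using lim unfolding I L .
qed

section \<open>Rescaling and passage to the expectation\<close>

lemma gen_airy_rescaled:
  assumes "\<alpha> > 1" "t > 0" "x \<noteq> 0"
  defines "a \<equiv> cos (pi / (2 * \<alpha>))" and "b \<equiv> sin (pi / (2 * \<alpha>))"
  shows "1 / (\<alpha> * t) powr (1 / \<alpha>) * gen_airy \<alpha> (x / (\<alpha> * t) powr (1 / \<alpha>))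
    = 1 / (pi * x) * (LINT y|lborel. weibull_density \<alpha> (1 / t) y * (sin (a * x * y) * exp (- b * x * y)))"
    (is "_ = 1 / (pi * x) * ?L")
proof -
  \<comment> \<open>Substituting \<open>m * s\<close> for \<open>s\<close> turns
    \<open>s powr \<alpha> / \<alpha>\<close> into \<open>t * s powr \<alpha>\<close>, because
    \<open>m powr \<alpha> = \<alpha> * t\<close>. The Jacobian \<open>m\<close> cancels the
    prefactor of the solution.\<close>
  define m where "m = (\<alpha> * t) powr (1 / \<alpha>)"
  have m: "m > 0" "m powr \<alpha> = \<alpha> * t"
    using assms(1,2) by (auto simp: m_def powr_powr)
  have rescale: "integral {0..R} (\<lambda>s. cos (s * (x / m) + s powr \<alpha> / \<alpha>))
      = m * integral {0..R / m} (\<lambda>s. cos (s * x + t * s powr \<alpha>))" if "R \<ge> 0" for R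
  proof -
    have "integral ((\<lambda>s. s / m) ` {0..R}) (\<lambda>s. cos ((m * s) * (x / m) + (m * s) powr \<alpha> / \<alpha>))
        = 1 / m * integral {0..R} (\<lambda>s. cos (s * (x / m) + s powr \<alpha> / \<alpha>))"
      using m(1) integral_stretch_real[of m 0 R "\<lambda>s. cos (s * (x / m) + s powr \<alpha> / \<alpha>)"] by simp
    moreover have "(\<lambda>s. s / m) ` {0..R} = {0..R / m}"
      using m(1) that by simp
    moreover have "integral {0..R / m} (\<lambda>s. cos ((m * s) * (x / m) + (m * s) powr \<alpha> / \<alpha>))
        = integral {0..R / m} (\<lambda>s. cos (s * x + t * s powr \<alpha>))"
      using m assms(1) by (intro integral_cong) (simp add: powr_mult)
    ultimately show ?thesis using m(1) by (simp add: field_simps)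
  qed
  have "\<forall>\<^sub>F R in at_top. m / x * (x * integral {0..R / m} (\<lambda>s. cos (s * x + t * s powr \<alpha>)))
      = integral {0..R} (\<lambda>s. cos (s * (x / m) + s powr \<alpha> / \<alpha>))"
    using eventually_ge_at_top[of 0]
    by eventually_elim (use assms(3) in \<open>simp only: rescale, simp\<close>)
  moreover have "((\<lambda>R. m / x * (x * integral {0..R / m} (\<lambda>s. cos (s * x + t * s powr \<alpha>))))
      \<longlongrightarrow> m / x * ?L) at_top"
  proof (intro tendsto_mult tendsto_const)
    have "filterlim (\<lambda>R. R / m) at_top at_top"
      using m(1) by real_asymp
    thus "((\<lambda>R. x * integral {0..R / m} (\<lambda>s. cos (s * x + t * s powr \<alpha>))) \<longlongrightarrow> ?L) at_top"
      unfolding a_def b_def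
      by (rule filterlim_compose[OF weibull_sin_exp_limit[OF assms(1,2)]])
  qed
  ultimately have "((\<lambda>R. integral {0..R} (\<lambda>s. cos (s * (x / m) + s powr \<alpha> / \<alpha>)))
      \<longlongrightarrow> m / x * ?L) at_top"
    by (subst (asm) tendsto_cong) auto
  hence "gen_airy \<alpha> (x / m) = 1 / pi * (m / x * ?L)"
    unfolding gen_airy_def by (subst tendsto_Lim[of at_top]) auto
  thus ?thesis using m(1) assms(3) by (simp flip: m_def)
qed

theorem mainTheorem8:
  fixes \<alpha> p x t :: real and M :: "'a measure" and G :: "'a \<Rightarrow> real"
  assumes "\<alpha> > 1" and "0 \<le> p" and "p \<le> 1"
    and "x \<noteq> 0" and "t > 0"
    and "prob_space M"
    and "distributed M lborel G (weibull_density \<alpha> (1 / t))"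
  defines "a \<equiv> cos (pi / (2 * \<alpha>))" and "b \<equiv> sin (pi / (2 * \<alpha>))"
  shows "integrable M (\<lambda>\<omega>. sin (a * x * G \<omega>) *
            (p * exp (b * x * G \<omega>) + (1 - p) * exp (- b * x * G \<omega>)))
       \<and> u_sol \<alpha> p x t =
          1 / (pi * x) * prob_space.expectation M (\<lambda>\<omega>. sin (a * x * G \<omega>) *
            (p * exp (b * x * G \<omega>) + (1 - p) * exp (- b * x * G \<omega>)))"
proof -
  have nonneg: "0 \<le> weibull_density \<alpha> (1 / t) y" for y
    using assms by (simp add: weibull_density_def)
  \<comment> \<open>The bound variable \<open>x\<close> is arbitrary here, since the facts are
    needed at both the given point and its negative.\<close>
  have int: "integrable M (\<lambda>\<omega>. sin (a * x * G \<omega>) * exp (- b * x * G \<omega>))"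
    and expectation: "(LINT y|lborel. weibull_density \<alpha> (1 / t) y * (sin (a * x * y) * exp (- b * x * y)))
      = (LINT \<omega>|M. sin (a * x * G \<omega>) * exp (- b * x * G \<omega>))" for x
    using weibull_sin_exp_integrable[OF assms(1,5), of x] assms(7)
    by (auto simp: a_def b_def distributed_integral distributed_integrable nonneg)
  \<comment> \<open>The summand with weight \<open>p\<close> is the other one reflected to
    \<open>- x\<close>; its minus sign comes from the oddness of the sine and later matches that of
    \<open>1 / (pi * - x)\<close>.\<close>
  have split: "sin (a * x * y) * (p * exp (b * x * y) + (1 - p) * exp (- b * x * y))
      = (1 - p) * (sin (a * x * y) * exp (- b * x * y))
        - p * (sin (a * (- x) * y) * exp (- b * (- x) * y))" for y
    by (simp add: algebra_simps)
  have "u_sol \<alpha> p x t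
      = p * (1 / (\<alpha> * t) powr (1 / \<alpha>) * gen_airy \<alpha> (- x / (\<alpha> * t) powr (1 / \<alpha>)))
        + (1 - p) * (1 / (\<alpha> * t) powr (1 / \<alpha>) * gen_airy \<alpha> (x / (\<alpha> * t) powr (1 / \<alpha>)))"
    unfolding u_sol_def by (simp only: distrib_left mult.left_commute)
  also have "\<dots> = p * (1 / (pi * - x) * (LINT \<omega>|M. sin (a * (- x) * G \<omega>) * exp (- b * (- x) * G \<omega>)))
        + (1 - p) * (1 / (pi * x) * (LINT \<omega>|M. sin (a * x * G \<omega>) * exp (- b * x * G \<omega>)))"
    using gen_airy_rescaled[OF assms(1,5), of x] gen_airy_rescaled[OF assms(1,5), of "- x"] assms(4)
    unfolding expectation[symmetric] unfolding a_def b_def by simp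
  also have "\<dots> = 1 / (pi * x) * ((1 - p) * (LINT \<omega>|M. sin (a * x * G \<omega>) * exp (- b * x * G \<omega>))
      - p * (LINT \<omega>|M. sin (a * (- x) * G \<omega>) * exp (- b * (- x) * G \<omega>)))"
    using assms(4) by (simp add: field_simps)
  also have "\<dots> = 1 / (pi * x) * (LINT \<omega>|M. (1 - p) * (sin (a * x * G \<omega>) * exp (- b * x * G \<omega>))
        - p * (sin (a * (- x) * G \<omega>) * exp (- b * (- x) * G \<omega>)))"
    using int[of x] int[of "- x"] by (subst Bochner_Integration.integral_diff) auto
  finally show ?thesis
    unfolding split using int[of x] int[of "- x"] by auto
qed

end
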